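(* For every integer $r\ge2$, the graph $N_r=K_r\vee(K_2\sqcup2K_1)$ has level depth $$d(N_r)=4\,r!.$$ Hence connected nice graphs that are not strongly nice can have arbitrarily large finite level depth.
   Context: For a finite simple graph $G=(V,E)$, the chromatic symmetric function is $X_G=\sum_{\kappa}\prod_{v\in V}x_{\kappa(v)}$, where the sum ranges over all proper colorings $\kappa:V\to\mathbb N=\{1,2,\ldots\}$. Write $X_G=\sum_{\lambda\vdash |V|}a_\lambda(G)m_\lambda$, where $m_\lambda$ are the monomial symmetric functions; the $a_\lambda(G)$ are nonnegative integers. For partitions $\lambda,\mu\vdash n$, $\lambda\ge\mu$ (dominance order) means $\sum_{i=1}^k\lambda_i\ge\sum_{i=1}^k\mu_i$ for every $k\ge1$ (parts beyond the length are $0$). $G$ is nice if for all $\lambda,\mu\vdash|V(G)|$ with $\lambda\ge\mu$, $a_\lambda(G)>0$ implies $a_\mu(G)>0$. $G$ is strongly nice if $a_\lambda(G)\le a_\mu(G)$ for all $\lambda,\mu\vdash|V(G)|$ with $\lambda\ge\mu$. For an integer $k\ge1$, $G$ is level-$k$ nice if, for all $\lambda,\mu\vdash|V(G)|$ with $\lambda\ge\mu$ and every integer $1\le j\le k$, the inequality $a_\lambda(G)\ge j$ implies $a_\mu(G)\ge j$. The level depth of $G$ is $$d(G):=\sup\bigl(\{k\in\mathbb N: G\text{ is level-}k\text{ nice}\}\cup\{0\}\bigr),$$ with $d(G)=\infty$ when the set is unbounded. $K_n$ is the complete graph on $n$ vertices, $\sqcup$ is disjoint union, and $2K_1$ is the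 graph with two vertices and no edges. The join $G\vee H$ of two vertex-disjoint graphs is obtained from $G\sqcup H$ by adding every edge between the two vertex sets. *)

theory Defs
  imports
    "Graph_Theory.Graph_Theory"
    "HOL-Library.Poly_Mapping"
    "HOL-Library.Extended_Nat"
    "HOL-Library.FuncSet"
    "HOL-Library.Multiset"
begin

text \<open>
  Finite simple graphs are the \<^locale>\<open>pair_graph\<close>s of the AFP entry Graph-Theory: finite, loop-free,
  symmetric digraphs without parallel arcs, an edge being the two arcs \<open>(u, v)\<close> and \<open>(v, u)\<close>.
\<close>

definition disjoint_union ::
    "'a pair_pre_digraph \<Rightarrow> 'a pair_pre_digraph \<Rightarrow> 'a pair_pre_digraph" (infixl \<open>\<squnion>\<^sub>g\<close> 65) where
  \<comment> \<open>meant for vertex-disjoint arguments only\<close>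
  "G \<squnion>\<^sub>g H = \<lparr> pverts = pverts G \<union> pverts H, parcs = parcs G \<union> parcs H \<rparr>"

definition graph_join ::
    "'a pair_pre_digraph \<Rightarrow> 'a pair_pre_digraph \<Rightarrow> 'a pair_pre_digraph" (infixl \<open>\<or>\<^sub>g\<close> 60) where
  \<comment> \<open>meant for vertex-disjoint arguments only\<close>
  "G \<or>\<^sub>g H = \<lparr> pverts = pverts (G \<squnion>\<^sub>g H),
     parcs = parcs (G \<squnion>\<^sub>g H) \<union> pverts G \<times> pverts H \<union> pverts H \<times> pverts G \<rparr>"

definition edgeless :: "nat \<Rightarrow> 'a pair_pre_digraph \<Rightarrow> bool" where
  "edgeless n G \<longleftrightarrow> finite (pverts G) \<and> card (pverts G) = n \<and> parcs G = {}"

definition is_N :: "nat \<Rightarrow> 'a pair_pre_digraph \<Rightarrow> bool" where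
  \<comment> \<open>\<open>G\<close> is a copy of \<open>N\<^sub>r\<close>, on an arbitrary vertex set\<close>
  "is_N r G \<longleftrightarrow> (\<exists>A B C. K\<^bsub>r\<^esub> (with_proj A) \<and> K\<^bsub>2\<^esub> (with_proj B) \<and> edgeless 2 C \<and>
     pverts B \<inter> pverts C = {} \<and> pverts A \<inter> pverts (B \<squnion>\<^sub>g C) = {} \<and>
     G = A \<or>\<^sub>g (B \<squnion>\<^sub>g C))"

text \<open>
  A formal power series in \<open>x\<^sub>1, x\<^sub>2, \<dots>\<close> is its coefficient function on monomials, and a monomial is its
  finitely supported exponent function (the exponent of the non-existent variable \<open>x\<^sub>0\<close> being \<open>0\<close>).
  Natural number coefficients suffice here.
\<close>

type_synonym power_series = "(nat \<Rightarrow>\<^sub>0 nat) \<Rightarrow> nat"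

definition proper_colorings :: "'a pair_pre_digraph \<Rightarrow> ('a \<Rightarrow> nat) set" where
  "proper_colorings G = {\<kappa> \<in> pverts G \<rightarrow>\<^sub>E {1..}. \<forall>(u, v) \<in> parcs G. \<kappa> u \<noteq> \<kappa> v}"

definition coloring_monomial :: "'a pair_pre_digraph \<Rightarrow> ('a \<Rightarrow> nat) \<Rightarrow> (nat \<Rightarrow>\<^sub>0 nat)" where
  \<comment> \<open>the product of the \<open>x\<^bsub>\<kappa> v\<^esub>\<close>; multiplying monomials adds exponents\<close>
  "coloring_monomial G \<kappa> = (\<Sum>v\<in>pverts G. Poly_Mapping.single (\<kappa> v) 1)"

definition chromatic_sf :: "'a pair_pre_digraph \<Rightarrow> power_series" where
  \<comment> \<open>the coefficient of \<open>\<alpha>\<close> in the sum of the monomials of all proper colorings\<close>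
  "chromatic_sf G = (\<lambda>\<alpha>. card {\<kappa> \<in> proper_colorings G. coloring_monomial G \<kappa> = \<alpha>})"

definition partitions :: "nat \<Rightarrow> nat list set" where
  "partitions n = {\<mu>. sorted_wrt (\<ge>) \<mu> \<and> 0 \<notin> set \<mu> \<and> sum_list \<mu> = n}"

definition dominance_ge :: "nat list \<Rightarrow> nat list \<Rightarrow> bool" (infix \<open>\<unrhd>\<close> 50) where
  "\<mu> \<unrhd> \<nu> \<longleftrightarrow> (\<forall>k\<ge>1. sum_list (take k \<mu>) \<ge> sum_list (take k \<nu>))"

definition monomial_sf :: "nat list \<Rightarrow> power_series" where
  \<comment> \<open>the sum of all distinct monomials in \<open>x\<^sub>1, x\<^sub>2, \<dots>\<close> whose non-zero exponents are the parts of \<open>\<mu>\<close>\<close>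
  "monomial_sf \<mu> = (\<lambda>\<alpha>. if 0 \<notin> Poly_Mapping.keys \<alpha> \<and>
      image_mset (Poly_Mapping.lookup \<alpha>) (mset_set (Poly_Mapping.keys \<alpha>)) = mset \<mu> then 1 else 0)"

definition is_monomial_expansion :: "'a pair_pre_digraph \<Rightarrow> (nat list \<Rightarrow> nat) \<Rightarrow> bool" where
  "is_monomial_expansion G a \<longleftrightarrow>
     chromatic_sf G = (\<lambda>\<alpha>. \<Sum>\<mu>\<in>partitions (card (pverts G)). a \<mu> * monomial_sf \<mu> \<alpha>) \<and>
     (\<forall>\<mu>. \<mu> \<notin> partitions (card (pverts G)) \<longrightarrow> a \<mu> = 0)"

definition mono_coeff :: "'a pair_pre_digraph \<Rightarrow> nat list \<Rightarrow> nat" where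
  \<comment> \<open>well-defined for every finite simple graph: \<open>ex1_monomial_expansion\<close> below\<close>
  "mono_coeff G = (THE a. is_monomial_expansion G a)"

definition nice :: "'a pair_pre_digraph \<Rightarrow> bool" where
  "nice G \<longleftrightarrow> (\<forall>\<mu>\<in>partitions (card (pverts G)). \<forall>\<nu>\<in>partitions (card (pverts G)).
     \<mu> \<unrhd> \<nu> \<longrightarrow> mono_coeff G \<mu> > 0 \<longrightarrow> mono_coeff G \<nu> > 0)"

definition strongly_nice :: "'a pair_pre_digraph \<Rightarrow> bool" where
  "strongly_nice G \<longleftrightarrow> (\<forall>\<mu>\<in>partitions (card (pverts G)). \<forall>\<nu>\<in>partitions (card (pverts G)).
     \<mu> \<unrhd> \<nu> \<longrightarrow> mono_coeff G \<mu> \<le> mono_coeff G \<nu>)"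

definition level_nice :: "nat \<Rightarrow> 'a pair_pre_digraph \<Rightarrow> bool" where
  "level_nice k G \<longleftrightarrow> (\<forall>\<mu>\<in>partitions (card (pverts G)). \<forall>\<nu>\<in>partitions (card (pverts G)).
     \<mu> \<unrhd> \<nu> \<longrightarrow> (\<forall>j\<in>{1..k}. mono_coeff G \<mu> \<ge> j \<longrightarrow> mono_coeff G \<nu> \<ge> j))"

definition level_depth :: "'a pair_pre_digraph \<Rightarrow> enat" where
  "level_depth G = Sup (enat ` {k. k \<ge> 1 \<and> level_nice k G} \<union> {0})"

lemma finite_partitions: "finite (partitions n)"
proof (rule finite_subset)
  show "partitions n \<subseteq> {xs. set xs \<subseteq> {..n} \<and> length xs \<le> n}"
  proof
    fix \<mu> assume "\<mu> \<in> partitions n"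
    then have s: "sum_list \<mu> = n" and z: "0 \<notin> set \<mu>" by (auto simp: partitions_def)
    have "length xs \<le> sum_list xs" if "0 \<notin> set xs" for xs :: "nat list"
      using that by (induction xs) auto
    then have "length \<mu> \<le> n" using s z by blast
    moreover have "set \<mu> \<subseteq> {..n}" using s member_le_sum_list by blast
    ultimately show "\<mu> \<in> {xs. set xs \<subseteq> {..n} \<and> length xs \<le> n}" by simp
  qed
  show "finite {xs. set xs \<subseteq> {..n} \<and> length xs \<le> n}" by (rule finite_lists_length_le) simp
qed

lemma lookup_coloring_monomial:
  assumes "finite (pverts G)"
  shows "Poly_Mapping.lookup (coloring_monomial G \<kappa>) i = card {v \<in> pverts G. \<kappa> v = i}"
  using assms
  by (simp add: coloring_monomial_def lookup_sum lookup_single when_def flip: sum.inter_filter)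

lemma keys_coloring_monomial:
  assumes "finite (pverts G)"
  shows "Poly_Mapping.keys (coloring_monomial G \<kappa>) = \<kappa> ` pverts G"
  using assms by (auto simp: in_keys_iff lookup_coloring_monomial card_eq_0_iff)

lemma finite_colorings_of_monomial:
  assumes "finite (pverts G)"
  shows "finite {\<kappa> \<in> proper_colorings G. coloring_monomial G \<kappa> = \<alpha>}"
proof (rule finite_subset)
  show "{\<kappa> \<in> proper_colorings G. coloring_monomial G \<kappa> = \<alpha>} \<subseteq> pverts G \<rightarrow>\<^sub>E Poly_Mapping.keys \<alpha>"
    using keys_coloring_monomial[OF assms] by (fastforce simp: proper_colorings_def)
  show "finite (pverts G \<rightarrow>\<^sub>E Poly_Mapping.keys \<alpha>)"
    using assms by (intro finite_PiE) auto
qed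

lemma chromatic_sf_le:
  assumes fin: "finite (pverts G)" and arcs: "parcs G \<subseteq> pverts G \<times> pverts G"
    and z: "0 \<notin> Poly_Mapping.keys \<beta>"
    and eq: "image_mset (Poly_Mapping.lookup \<alpha>) (mset_set (Poly_Mapping.keys \<alpha>)) =
             image_mset (Poly_Mapping.lookup \<beta>) (mset_set (Poly_Mapping.keys \<beta>))"
  shows "chromatic_sf G \<alpha> \<le> chromatic_sf G \<beta>"
proof -
  have "card (Poly_Mapping.keys \<alpha>) = card (Poly_Mapping.keys \<beta>)"
    using arg_cong[OF eq, of size] by simp
  then obtain g where g: "bij_betw g (Poly_Mapping.keys \<alpha>) (Poly_Mapping.keys \<beta>)"
    using finite_same_card_bij by (metis finite_keys)
  then have im: "mset_set (Poly_Mapping.keys \<beta>) = image_mset g (mset_set (Poly_Mapping.keys \<alpha>))"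
    by (simp add: image_mset_mset_set bij_betw_def)
  obtain p where p: "p permutes Poly_Mapping.keys \<alpha>"
      "\<And>x. x \<in> Poly_Mapping.keys \<alpha> \<Longrightarrow>
         Poly_Mapping.lookup \<alpha> x = (Poly_Mapping.lookup \<beta> \<circ> g) (p x)"
    using image_mset_eq_implies_permutes[of "Poly_Mapping.keys \<alpha>" "Poly_Mapping.lookup \<alpha>"
        "Poly_Mapping.lookup \<beta> \<circ> g"] eq im
    by (metis finite_keys multiset.map_comp)
  define f where "f = g \<circ> p"
  have f: "bij_betw f (Poly_Mapping.keys \<alpha>) (Poly_Mapping.keys \<beta>)"
    unfolding f_def using permutes_imp_bij[OF p(1)] g by (rule bij_betw_trans)
  have lf: "Poly_Mapping.lookup \<beta> (f x) = Poly_Mapping.lookup \<alpha> x" if "x \<in> Poly_Mapping.keys \<alpha>" for x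
    using p(2)[OF that] by (simp add: f_def)
  let ?S = "\<lambda>\<alpha>. {\<kappa> \<in> proper_colorings G. coloring_monomial G \<kappa> = \<alpha>}"
  let ?F = "\<lambda>\<kappa>. restrict (f \<circ> \<kappa>) (pverts G)"
  have im\<kappa>: "\<kappa> ` pverts G = Poly_Mapping.keys \<alpha>" if "\<kappa> \<in> ?S \<alpha>" for \<kappa>
    using that keys_coloring_monomial[OF fin] by auto
  have injf: "inj_on f (Poly_Mapping.keys \<alpha>)" using f by (rule bij_betw_imp_inj_on)
  have "card (?S \<alpha>) \<le> card (?S \<beta>)"
  proof (rule card_inj_on_le)
    show "inj_on ?F (?S \<alpha>)"
    proof (rule inj_onI)
      fix \<kappa> \<kappa>' assume k: "\<kappa> \<in> ?S \<alpha>" "\<kappa>' \<in> ?S \<alpha>" and e: "?F \<kappa> = ?F \<kappa>'"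
      show "\<kappa> = \<kappa>'"
      proof (rule PiE_ext)
        show "\<kappa> \<in> pverts G \<rightarrow>\<^sub>E {1..}" "\<kappa>' \<in> pverts G \<rightarrow>\<^sub>E {1..}"
          using k by (auto simp: proper_colorings_def)
        fix v assume v: "v \<in> pverts G"
        then have "f (\<kappa> v) = f (\<kappa>' v)" using fun_cong[OF e, of v] by simp
        moreover have "\<kappa> v \<in> Poly_Mapping.keys \<alpha>" "\<kappa>' v \<in> Poly_Mapping.keys \<alpha>"
          using im\<kappa>[OF k(1)] im\<kappa>[OF k(2)] v by blast+
        ultimately show "\<kappa> v = \<kappa>' v" using injf by (auto dest: inj_onD)
      qed
    qed
    show "?F ` ?S \<alpha> \<subseteq> ?S \<beta>"
    proof (rule image_subsetI)
      fix \<kappa> assume k: "\<kappa> \<in> ?S \<alpha>"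
      have mem: "\<kappa> v \<in> Poly_Mapping.keys \<alpha>" if "v \<in> pverts G" for v
        using im\<kappa>[OF k] that by blast
      have memb: "f (\<kappa> v) \<in> Poly_Mapping.keys \<beta>" if "v \<in> pverts G" for v
        using mem[OF that] f by (auto simp: bij_betw_def)
      have pos: "f (\<kappa> v) \<ge> 1" if "v \<in> pverts G" for v
        using memb[OF that] z by (metis less_one not_le)
      have "f (\<kappa> u) \<noteq> f (\<kappa> v)" if "(u, v) \<in> parcs G" for u v
      proof -
        have uv: "u \<in> pverts G" "v \<in> pverts G" using that arcs by auto
        have "\<kappa> u \<noteq> \<kappa> v" using k that by (auto simp: proper_colorings_def)
        then show ?thesis using injf mem[OF uv(1)] mem[OF uv(2)] by (auto dest: inj_onD)
      qed
      then have "?F \<kappa> \<in> proper_colorings G"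
        using pos arcs by (auto simp: proper_colorings_def)
      moreover have "coloring_monomial G (?F \<kappa>) = \<beta>"
      proof (rule poly_mapping_eqI)
        fix i
        show "Poly_Mapping.lookup (coloring_monomial G (?F \<kappa>)) i = Poly_Mapping.lookup \<beta> i"
        proof (cases "i \<in> Poly_Mapping.keys \<beta>")
          case True
          then obtain x where x: "x \<in> Poly_Mapping.keys \<alpha>" "i = f x"
            using f by (auto simp: bij_betw_def)
          have "{v \<in> pverts G. ?F \<kappa> v = i} = {v \<in> pverts G. \<kappa> v = x}"
            using x injf mem by (auto dest: inj_onD)
          then have "Poly_Mapping.lookup (coloring_monomial G (?F \<kappa>)) i =
              Poly_Mapping.lookup (coloring_monomial G \<kappa>) x"
            by (simp only: lookup_coloring_monomial[OF fin])
          then show ?thesis using k lf[OF x(1)] x(2) by simp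
        next
          case False
          then have "{v \<in> pverts G. ?F \<kappa> v = i} = {}" using memb by auto
          then have "Poly_Mapping.lookup (coloring_monomial G (?F \<kappa>)) i = 0"
            by (simp only: lookup_coloring_monomial[OF fin] card.empty)
          then show ?thesis using False by (simp add: in_keys_iff)
        qed
      qed
      ultimately show "?F \<kappa> \<in> ?S \<beta>" by simp
    qed
    show "finite (?S \<beta>)" by (rule finite_colorings_of_monomial[OF fin])
  qed
  then show ?thesis by (simp add: chromatic_sf_def)
qed

lemma monomial_sf_eq_1_iff:
  "monomial_sf \<mu> \<alpha> = 1 \<longleftrightarrow> 0 \<notin> Poly_Mapping.keys \<alpha> \<and>
     image_mset (Poly_Mapping.lookup \<alpha>) (mset_set (Poly_Mapping.keys \<alpha>)) = mset \<mu>"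
  by (simp add: monomial_sf_def)

lemma partitions_mset_eqD:
  assumes "\<mu> \<in> partitions m" "\<nu> \<in> partitions n" "mset \<mu> = mset \<nu>"
  shows "\<mu> = \<nu>"
proof -
  have "sorted (rev \<mu>)" "sorted (rev \<nu>)"
    using assms by (auto simp: partitions_def sorted_wrt_rev)
  then have "rev \<mu> = rev \<nu>"
    using assms(3) by (metis mset_rev properties_for_sort)
  then show ?thesis by simp
qed

lemma monomial_of_partition:
  assumes "\<mu> \<in> partitions n"
  obtains \<alpha> where "monomial_sf \<mu> \<alpha> = 1"
proof -
  define f where "f = (\<lambda>i. if 1 \<le> i \<and> i \<le> length \<mu> then \<mu> ! (i - 1) else 0)"
  have pos: "\<mu> ! i \<noteq> 0" if "i < length \<mu>" for i
    using assms that by (metis (mono_tags, lifting) mem_Collect_eq nth_mem partitions_def)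
  have supp: "{i. f i \<noteq> 0} = Suc ` {..<length \<mu>}"
  proof (intro set_eqI iffI)
    fix i assume "i \<in> {i. f i \<noteq> 0}"
    then have "1 \<le> i" "i \<le> length \<mu>" by (auto simp: f_def split: if_splits)
    then have "i = Suc (i - 1)" "i - 1 < length \<mu>" by auto
    then show "i \<in> Suc ` {..<length \<mu>}" by blast
  next
    fix i assume "i \<in> Suc ` {..<length \<mu>}"
    then obtain j where "i = Suc j" "j < length \<mu>" by blast
    then show "i \<in> {i. f i \<noteq> 0}" using pos[of j] by (simp add: f_def)
  qed
  define \<alpha> where "\<alpha> = Abs_poly_mapping f"
  have lk: "Poly_Mapping.lookup \<alpha> = f"
    unfolding \<alpha>_def by (rule Abs_poly_mapping_inverse) (unfold mem_Collect_eq supp, simp)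
  have keys: "Poly_Mapping.keys \<alpha> = Suc ` {..<length \<mu>}"
    using supp by (auto simp: keys.rep_eq lk)
  have "image_mset f (mset_set (Suc ` {..<length \<mu>})) =
      image_mset (\<lambda>i. f (Suc i)) (mset_set {..<length \<mu>})"
  proof -
    have "mset_set (Suc ` {..<length \<mu>}) = image_mset Suc (mset_set {..<length \<mu>})"
      by (rule image_mset_mset_set[symmetric]) simp
    then show ?thesis by (simp only: multiset.map_comp comp_def)
  qed
  also have "\<dots> = image_mset (\<lambda>i. \<mu> ! i) (mset_set {..<length \<mu>})"
    by (intro image_mset_cong) (auto simp: f_def)
  also have "\<dots> = mset (map (\<lambda>i. \<mu> ! i) [0..<length \<mu>])"
    by (metis atLeast_upt mset_map mset_set_upto_eq_mset_upto)
  also have "\<dots> = mset \<mu>" by (simp only: map_nth)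
  finally have "monomial_sf \<mu> \<alpha> = 1" by (auto simp: monomial_sf_def lk keys)
  then show ?thesis by (rule that)
qed

lemma partition_of_monomial:
  assumes fin: "finite (pverts G)" and nz: "chromatic_sf G \<alpha> \<noteq> 0"
  obtains \<mu> where "\<mu> \<in> partitions (card (pverts G))" "monomial_sf \<mu> \<alpha> = 1"
proof -
  let ?M = "image_mset (Poly_Mapping.lookup \<alpha>) (mset_set (Poly_Mapping.keys \<alpha>))"
  define \<mu> where "\<mu> = rev (sorted_list_of_multiset ?M)"
  obtain \<kappa> where k: "\<kappa> \<in> proper_colorings G" "coloring_monomial G \<kappa> = \<alpha>"
  proof -
    have "{\<kappa> \<in> proper_colorings G. coloring_monomial G \<kappa> = \<alpha>} \<noteq> {}"
      using nz unfolding chromatic_sf_def by (metis card.empty)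
    then show ?thesis using that by blast
  qed
  have keys: "Poly_Mapping.keys \<alpha> = \<kappa> ` pverts G" using keys_coloring_monomial[OF fin] k(2) by auto
  have z: "0 \<notin> Poly_Mapping.keys \<alpha>" using k(1) by (force simp: keys proper_colorings_def PiE_def Pi_def)
  have ms: "mset \<mu> = ?M" by (simp add: \<mu>_def)
  have "sum_list \<mu> = sum_mset ?M" by (metis ms sum_mset_sum_list)
  also have "\<dots> = (\<Sum>i\<in>Poly_Mapping.keys \<alpha>. Poly_Mapping.lookup \<alpha> i)"
    by (simp add: sum_unfold_sum_mset)
  also have "\<dots> = (\<Sum>i\<in>\<kappa> ` pverts G. card {v \<in> pverts G. \<kappa> v = i})"
    using k(2) keys by (auto simp: lookup_coloring_monomial[OF fin])
  also have "\<dots> = card (pverts G)"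
    using sum.image_gen[OF fin, of "\<lambda>_. 1::nat" \<kappa>] by simp
  finally have "sum_list \<mu> = card (pverts G)" .
  moreover have "0 \<notin> set \<mu>"
  proof -
    have "set \<mu> = set_mset ?M" using ms by (metis set_mset_mset)
    then show ?thesis by (auto simp: in_keys_iff)
  qed
  moreover have "sorted_wrt (\<ge>) \<mu>" by (simp add: \<mu>_def sorted_wrt_rev)
  ultimately have "\<mu> \<in> partitions (card (pverts G))" by (simp add: partitions_def)
  moreover have "monomial_sf \<mu> \<alpha> = 1" using z ms by (simp add: monomial_sf_def)
  ultimately show ?thesis by (rule that)
qed

lemma sum_monomial_sf:
  assumes "\<mu> \<in> partitions n" "monomial_sf \<mu> \<alpha> = 1"
  shows "(\<Sum>\<nu>\<in>partitions n. a \<nu> * monomial_sf \<nu> \<alpha>) = a \<mu>"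
proof -
  have "monomial_sf \<nu> \<alpha> = (if \<nu> = \<mu> then 1 else 0)" if "\<nu> \<in> partitions n" for \<nu>
  proof (cases "\<nu> = \<mu>")
    case True
    then show ?thesis using assms(2) by simp
  next
    case False
    then have "mset \<nu> \<noteq> mset \<mu>" using partitions_mset_eqD[OF that assms(1)] by blast
    moreover have "image_mset (Poly_Mapping.lookup \<alpha>) (mset_set (Poly_Mapping.keys \<alpha>)) = mset \<mu>"
      using assms(2) unfolding monomial_sf_eq_1_iff by blast
    ultimately show ?thesis using False by (simp add: monomial_sf_def)
  qed
  then have "(\<Sum>\<nu>\<in>partitions n. a \<nu> * monomial_sf \<nu> \<alpha>) =
      (\<Sum>\<nu>\<in>partitions n. if \<nu> = \<mu> then a \<nu> else 0)"
    by (intro sum.cong) auto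
  then show ?thesis using assms(1) by (simp add: finite_partitions)
qed

lemma ex1_monomial_expansion:
  assumes "pair_graph G"
  shows "\<exists>!a. is_monomial_expansion G a"
proof -
  interpret pair_graph G by fact
  have fin: "finite (pverts G)" by (rule pair_finite_verts)
  have arcs: "parcs G \<subseteq> pverts G \<times> pverts G" using in_arcsD1 in_arcsD2 by auto
  let ?P = "partitions (card (pverts G))"
  define a where "a \<mu> = (if \<mu> \<in> ?P then chromatic_sf G (SOME \<alpha>. monomial_sf \<mu> \<alpha> = 1) else 0)" for \<mu>
  have a: "a \<mu> = chromatic_sf G \<alpha>" if "\<mu> \<in> ?P" "monomial_sf \<mu> \<alpha> = 1" for \<mu> \<alpha>
  proof -
    let ?\<beta> = "SOME \<alpha>. monomial_sf \<mu> \<alpha> = 1"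
    have "monomial_sf \<mu> ?\<beta> = 1" using that(2) by (rule someI)
    note b' = iffD1[OF monomial_sf_eq_1_iff this]
    have b: "0 \<notin> Poly_Mapping.keys ?\<beta>"
        "image_mset (Poly_Mapping.lookup ?\<beta>) (mset_set (Poly_Mapping.keys ?\<beta>)) = mset \<mu>"
      by (rule conjunct1[OF b'], rule conjunct2[OF b'])
    have c: "0 \<notin> Poly_Mapping.keys \<alpha>"
        "image_mset (Poly_Mapping.lookup \<alpha>) (mset_set (Poly_Mapping.keys \<alpha>)) = mset \<mu>"
      using that(2) unfolding monomial_sf_eq_1_iff by blast+
    have "chromatic_sf G ?\<beta> = chromatic_sf G \<alpha>"
    proof (rule antisym)
      show "chromatic_sf G ?\<beta> \<le> chromatic_sf G \<alpha>"
        by (rule chromatic_sf_le[OF fin arcs c(1)]) (simp only: b c)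
      show "chromatic_sf G \<alpha> \<le> chromatic_sf G ?\<beta>"
        by (rule chromatic_sf_le[OF fin arcs b(1)]) (simp only: b c)
    qed
    then show ?thesis unfolding a_def using that(1) by (simp only: if_True)
  qed
  show ?thesis
  proof (rule ex1I)
    have "chromatic_sf G \<alpha> = (\<Sum>\<mu>\<in>?P. a \<mu> * monomial_sf \<mu> \<alpha>)" for \<alpha>
    proof (cases "\<exists>\<mu>\<in>?P. monomial_sf \<mu> \<alpha> = 1")
      case True
      then obtain \<mu> where m: "\<mu> \<in> ?P" "monomial_sf \<mu> \<alpha> = 1" by blast
      show ?thesis by (simp only: sum_monomial_sf[OF m] a[OF m])
    next
      case False
      then have "chromatic_sf G \<alpha> = 0" using partition_of_monomial[OF fin] by blast
      moreover have "monomial_sf \<mu> \<alpha> = 0" if "\<mu> \<in> ?P" for \<mu>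
      proof -
        have "monomial_sf \<mu> \<alpha> \<noteq> 1" using False that by blast
        moreover have "monomial_sf \<mu> \<alpha> \<in> {0, 1}" unfolding monomial_sf_def by simp
        ultimately show ?thesis by blast
      qed
      ultimately show ?thesis by simp
    qed
    then have "chromatic_sf G = (\<lambda>\<alpha>. \<Sum>\<mu>\<in>?P. a \<mu> * monomial_sf \<mu> \<alpha>)" by (rule ext)
    moreover have "\<forall>\<mu>. \<mu> \<notin> ?P \<longrightarrow> a \<mu> = 0" by (simp add: a_def)
    ultimately show "is_monomial_expansion G a" unfolding is_monomial_expansion_def by (rule conjI)
  next
    fix b assume b: "is_monomial_expansion G b"
    show "b = a"
    proof
      fix \<mu>
      show "b \<mu> = a \<mu>"
      proof (cases "\<mu> \<in> ?P")
        case True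
        then obtain \<alpha> where al: "monomial_sf \<mu> \<alpha> = 1" by (rule monomial_of_partition)
        have "chromatic_sf G \<alpha> = b \<mu>"
          using b sum_monomial_sf[OF True al, of b] by (simp add: is_monomial_expansion_def)
        then show ?thesis using a[OF True al] by simp
      next
        case False
        then show ?thesis using b by (simp add: is_monomial_expansion_def a_def)
      qed
    qed
  qed
qed

lemma mono_coeff_eq:
  assumes "pair_graph G" "\<mu> \<in> partitions (card (pverts G))" "monomial_sf \<mu> \<alpha> = 1"
  shows "mono_coeff G \<mu> = chromatic_sf G \<alpha>"
proof -
  have "is_monomial_expansion G (mono_coeff G)"
    unfolding mono_coeff_def by (rule theI'[OF ex1_monomial_expansion[OF assms(1)]])
  then show ?thesis
    using sum_monomial_sf[OF assms(2,3), of "mono_coeff G"] by (simp add: is_monomial_expansion_def)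
qed

lemma pair_graph_is_N:
  assumes "is_N r G"
  shows "pair_graph G"
proof -
  obtain A B C where A: "K\<^bsub>r\<^esub> (with_proj A)" and B: "K\<^bsub>2\<^esub> (with_proj B)" and C: "edgeless 2 C"
    and d: "pverts B \<inter> pverts C = {}" "pverts A \<inter> pverts (B \<squnion>\<^sub>g C) = {}"
    and G: "G = A \<or>\<^sub>g (B \<squnion>\<^sub>g C)"
    using assms by (auto simp: is_N_def)
  have fin: "finite (pverts G)"
    using A B C by (auto simp: G graph_join_def disjoint_union_def complete_digraph_pair_def edgeless_def)
  have sub: "parcs G \<subseteq> pverts G \<times> pverts G"
    using A B C by (auto simp: G graph_join_def disjoint_union_def complete_digraph_pair_def edgeless_def)
  have "finite (parcs G)" using fin sub by (meson finite_SigmaI finite_subset)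
  moreover have "sym (parcs G)" "\<forall>e\<in>parcs G. fst e \<noteq> snd e"
    using A B C d
    by (auto simp: G graph_join_def disjoint_union_def complete_digraph_pair_def edgeless_def sym_def)
  ultimately show ?thesis
    using fin sub by unfold_locales (auto simp: symmetric_def)
qed

lemma ex_is_N: "\<exists>G :: nat pair_pre_digraph. is_N r G"
proof -
  define A where "A = \<lparr> pverts = {..<r}, parcs = {(u, v). (u, v) \<in> {..<r} \<times> {..<r} \<and> u \<noteq> v} \<rparr>"
  define B where "B = \<lparr> pverts = {r, r + 1}, parcs = {(r, r + 1), (r + 1, r)} \<rparr>"
  define C where "C = \<lparr> pverts = {r + 2, r + 3}, parcs = ({} :: nat rel) \<rparr>"
  have "K\<^bsub>r\<^esub> (with_proj A)" by (simp add: complete_digraph_pair_def A_def)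
  moreover have "K\<^bsub>2\<^esub> (with_proj B)" by (auto simp: complete_digraph_pair_def B_def)
  moreover have "edgeless 2 C" by (simp add: edgeless_def C_def)
  moreover have "pverts B \<inter> pverts C = {}" "pverts A \<inter> pverts (B \<squnion>\<^sub>g C) = {}"
    by (auto simp: A_def B_def C_def disjoint_union_def)
  ultimately have "is_N r (A \<or>\<^sub>g (B \<squnion>\<^sub>g C))" unfolding is_N_def by blast
  then show ?thesis ..
qed

end

theory Submission
  imports Defs
begin

text \<open>
  Fix one monomial whose exponents are the parts of \<open>\<mu>\<close>: then \<open>a\<^sub>\<mu>(G)\<close> is the number of proper colorings of
  \<open>G\<close> in which every color is used as often as its exponent says. The graph \<open>N\<^sub>r\<close> is a threshold graph:
  it arises from the empty graph by adding two dominating vertices (giving \<open>K\<^sub>2\<close>), then two isolated ones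
  (giving \<open>K\<^sub>2 \<squnion> 2K\<^sub>1\<close>), then \<open>r\<close> dominating ones. For both kinds of vertices the coefficients satisfy a
  recursion in the multiset \<open>M\<close> of parts: a new dominating vertex must be alone in its color class, so it
  takes one of the parts equal to \<open>1\<close> and deletes it (\<open>has_coeffs_add_dominating\<close>); a new isolated vertex may
  have any color, so it takes any part and decreases it by \<open>1\<close> (\<open>has_coeffs_add_isolated\<close>).

  For \<open>K\<^sub>2 \<squnion> 2K\<^sub>1\<close> the recursion yields the coefficients \<open>2, 4, 10, 24\<close> at \<open>(3,1), (2,2), (2,1,1), (1,1,1,1)\<close>.
  If \<open>M\<close> has \<open>k\<close> parts equal to \<open>1\<close>, then \<open>r\<close> further dominating vertices and \<open>r\<close> further parts \<open>1\<close> multiply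
  the coefficient at \<open>M\<close> by \<open>(k+1)(k+2)\<cdots>(k+r)\<close> (\<open>N_coeff_add_ones\<close>). Hence \<open>N\<^sub>r\<close> has the coefficients
  \<open>2(r+1)!\<close> at \<open>(3,1\<^sup>r\<^sup>+\<^sup>1)\<close>, \<open>4 r!\<close> at \<open>(2,2,1\<^sup>r)\<close>, \<open>5(r+2)!\<close> at \<open>(2,1\<^sup>r\<^sup>+\<^sup>2)\<close> and \<open>(r+4)!\<close> at \<open>(1\<^sup>r\<^sup>+\<^sup>4)\<close>.

  These four partitions are exactly the partitions of \<open>r + 4\<close> with at least \<open>r + 2\<close> parts, and a coefficient
  at a partition with fewer parts vanishes (\<open>N_coeff_support\<close>). As passing to a dominated partition never
  decreases the number of parts (\<open>dominance_length_le\<close>), everything dominated by a partition with positive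
  coefficient has a coefficient of at least \<open>4 r!\<close>, the smallest of the four values (\<open>N_coeff_lower_bound\<close>).
  So \<open>N\<^sub>r\<close> is nice, and level-\<open>k\<close> nice for every \<open>k \<le> 4 r!\<close>. Level \<open>4 r! + 1\<close> fails, because \<open>(3,1\<^sup>r\<^sup>+\<^sup>1)\<close>
  dominates \<open>(2,2,1\<^sup>r)\<close> while \<open>2(r+1)! > 4 r!\<close> for \<open>r \<ge> 2\<close>.
\<close>

section \<open>Coefficients as functions of the multiset of parts\<close>

definition exponents :: "(nat \<Rightarrow>\<^sub>0 nat) \<Rightarrow> nat multiset" where
  "exponents \<alpha> = image_mset (Poly_Mapping.lookup \<alpha>) (mset_set (Poly_Mapping.keys \<alpha>))"

text \<open>
  For the multiset \<open>M\<close> of parts of \<open>\<mu>\<close>, \<open>c M\<close> is the coefficient \<open>a\<^sub>\<mu>(G)\<close>. Multisets replace sorted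
  lists here because removing or decreasing a part need not keep a list sorted. The arcs are required to stay
  inside the vertex set so that a vertex added later brings in only the arcs attached to it explicitly.
\<close>

definition has_coeffs :: "'a pair_pre_digraph \<Rightarrow> (nat multiset \<Rightarrow> nat) \<Rightarrow> bool" where
  "has_coeffs G c \<longleftrightarrow> finite (pverts G) \<and> parcs G \<subseteq> pverts G \<times> pverts G \<and>
     (\<forall>\<alpha>. 0 \<notin> Poly_Mapping.keys \<alpha> \<longrightarrow> chromatic_sf G \<alpha> = c (exponents \<alpha>))"

lemma mono_coeff_has_coeffs:
  assumes "pair_graph G" "has_coeffs G c" "\<mu> \<in> partitions (card (pverts G))"
  shows "mono_coeff G \<mu> = c (mset \<mu>)"
proof -
  obtain \<alpha> where \<alpha>: "monomial_sf \<mu> \<alpha> = 1" using assms(3) by (rule monomial_of_partition)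
  have "0 \<notin> Poly_Mapping.keys \<alpha>" "exponents \<alpha> = mset \<mu>"
    using \<alpha> unfolding monomial_sf_eq_1_iff exponents_def by blast+
  then show ?thesis using mono_coeff_eq[OF assms(1,3) \<alpha>] assms(2) by (simp add: has_coeffs_def)
qed

definition empty_graph :: "'a pair_pre_digraph" where
  "empty_graph = \<lparr> pverts = {}, parcs = {} \<rparr>"

text \<open>The empty graph has a single coloring, the empty one, and its monomial is \<open>1\<close>.\<close>

lemma has_coeffs_empty: "has_coeffs empty_graph (\<lambda>M. if M = {#} then 1 else 0)"
proof -
  have "chromatic_sf (empty_graph :: 'a pair_pre_digraph) \<alpha> = (if exponents \<alpha> = {#} then 1 else 0)" for \<alpha>
  proof -
    have "exponents \<alpha> = {#} \<longleftrightarrow> \<alpha> = 0" by (simp add: exponents_def mset_set_empty_iff)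
    moreover have "{\<kappa> \<in> proper_colorings (empty_graph :: 'a pair_pre_digraph).
        coloring_monomial (empty_graph :: 'a pair_pre_digraph) \<kappa> = \<alpha>} =
        (if \<alpha> = 0 then {\<lambda>x. undefined} else {})"
      by (auto simp: proper_colorings_def coloring_monomial_def empty_graph_def)
    ultimately show ?thesis by (simp add: chromatic_sf_def)
  qed
  then show ?thesis by (simp add: has_coeffs_def) (simp add: empty_graph_def)
qed

section \<open>Adding an isolated or a dominating vertex\<close>

definition add_vertex :: "'a \<Rightarrow> 'a set \<Rightarrow> 'a pair_pre_digraph \<Rightarrow> 'a pair_pre_digraph" where
  "add_vertex v W G = \<lparr> pverts = insert v (pverts G), parcs = parcs G \<union> {v} \<times> W \<union> W \<times> {v} \<rparr>"

abbreviation add_isolated :: "'a \<Rightarrow> 'a pair_pre_digraph \<Rightarrow> 'a pair_pre_digraph" where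
  "add_isolated v G \<equiv> add_vertex v {} G"

abbreviation add_dominating :: "'a \<Rightarrow> 'a pair_pre_digraph \<Rightarrow> 'a pair_pre_digraph" where
  "add_dominating v G \<equiv> add_vertex v (pverts G) G"

definition dominating_coeff :: "(nat multiset \<Rightarrow> nat) \<Rightarrow> nat multiset \<Rightarrow> nat" where
  "dominating_coeff c M = count M 1 * c (M - {#1#})"

text \<open>A part that would become \<open>0\<close> is dropped.\<close>

definition decrement_part :: "nat \<Rightarrow> nat multiset \<Rightarrow> nat multiset" where
  "decrement_part p M = M - {#p#} + (if p \<le> 1 then {#} else {#p - 1#})"

definition isolated_coeff :: "(nat multiset \<Rightarrow> nat) \<Rightarrow> nat multiset \<Rightarrow> nat" where
  "isolated_coeff c M = (\<Sum>p\<in>#M. c (decrement_part p M))"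

lemma exponents_decrement:
  assumes "i \<in> Poly_Mapping.keys \<alpha>"
  shows "exponents (\<alpha> - Poly_Mapping.single i 1) = decrement_part (Poly_Mapping.lookup \<alpha> i) (exponents \<alpha>)"
proof -
  let ?\<beta> = "\<alpha> - Poly_Mapping.single i 1" and ?K = "Poly_Mapping.keys \<alpha>"
  let ?p = "Poly_Mapping.lookup \<alpha> i"
  have lk: "Poly_Mapping.lookup ?\<beta> j = Poly_Mapping.lookup \<alpha> j - (if j = i then 1 else 0)" for j
    by (simp add: lookup_minus lookup_single when_def)
  have K: "mset_set ?K = {#i#} + mset_set (?K - {i})"
    using assms by (simp add: mset_set.remove)
  have p: "?p \<noteq> 0" using assms by (simp add: in_keys_iff)
  have rest: "image_mset (Poly_Mapping.lookup ?\<beta>) (mset_set (?K - {i})) =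
      image_mset (Poly_Mapping.lookup \<alpha>) (mset_set (?K - {i}))"
    by (intro image_mset_cong) (simp add: lk[simplified])
  have keys: "Poly_Mapping.keys ?\<beta> = (if ?p \<le> 1 then ?K - {i} else insert i (?K - {i}))"
    using p by (auto simp: in_keys_iff lk[simplified] split: if_splits)
  have "exponents \<alpha> - {#?p#} = image_mset (Poly_Mapping.lookup \<alpha>) (mset_set (?K - {i}))"
    unfolding exponents_def K by simp
  then show ?thesis
    unfolding exponents_def[of ?\<beta>] keys decrement_part_def using rest lk[of i]
    by (simp del: insert_Diff_single One_nat_def)
qed

lemma coloring_monomial_add_vertex:
  assumes "finite (pverts G)" and "v \<notin> pverts G"
  shows "coloring_monomial (add_vertex v W G) \<kappa> =
    Poly_Mapping.single (\<kappa> v) 1 + coloring_monomial G (restrict \<kappa> (pverts G))"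
  using assms by (simp add: coloring_monomial_def add_vertex_def)

text \<open>
  The restriction to the old vertices forgets only the color of \<open>v\<close>, which has to be valid and to differ from
  the colors of the neighbors \<open>W\<close> of \<open>v\<close>.
\<close>

lemma proper_colorings_add_vertex_iff:
  assumes arcs: "parcs G \<subseteq> pverts G \<times> pverts G" and v: "v \<notin> pverts G" and W: "W \<subseteq> pverts G"
  shows "\<kappa> \<in> proper_colorings (add_vertex v W G) \<longleftrightarrow>
    \<kappa> \<in> insert v (pverts G) \<rightarrow>\<^sub>E UNIV \<and> 1 \<le> \<kappa> v \<and> \<kappa> v \<notin> \<kappa> ` W \<and>
    restrict \<kappa> (pverts G) \<in> proper_colorings G"
proof -
  have old: "(\<forall>(u, w)\<in>parcs G. restrict \<kappa> (pverts G) u \<noteq> restrict \<kappa> (pverts G) w) \<longleftrightarrow>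
      (\<forall>(u, w)\<in>parcs G. \<kappa> u \<noteq> \<kappa> w)"
    using arcs by (intro ball_cong) auto
  have new: "(\<forall>(u, w)\<in>parcs (add_vertex v W G). \<kappa> u \<noteq> \<kappa> w) \<longleftrightarrow>
      (\<forall>(u, w)\<in>parcs G. \<kappa> u \<noteq> \<kappa> w) \<and> \<kappa> v \<notin> \<kappa> ` W"
    unfolding add_vertex_def by (simp add: ball_Un) (metis image_iff)
  have "\<kappa> \<in> pverts (add_vertex v W G) \<rightarrow>\<^sub>E {1..} \<longleftrightarrow> \<kappa> \<in> insert v (pverts G) \<rightarrow>\<^sub>E UNIV \<and> 1 \<le> \<kappa> v \<and>
      restrict \<kappa> (pverts G) \<in> pverts G \<rightarrow>\<^sub>E {1..}"
    by (auto simp: add_vertex_def PiE_def Pi_def)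
  then show ?thesis using old new unfolding proper_colorings_def by blast
qed

text \<open>
  Colorings of the larger graph are sorted by the color \<open>i\<close> of \<open>v\<close>: once \<open>i\<close> is fixed, the restriction is a
  coloring of \<open>G\<close> with the exponent of \<open>x\<^sub>i\<close> decreased by \<open>1\<close>. The color \<open>i\<close> is available if no neighbor uses it.
  The sum over \<open>i\<close> decouples from the colorings only when this depends on the monomial alone, which is what
  the set \<open>I\<close> expresses; it does so for isolated and for dominating vertices, but not for general \<open>W\<close>.
\<close>

lemma chromatic_sf_add_vertex:
  assumes fin: "finite (pverts G)" and arcs: "parcs G \<subseteq> pverts G \<times> pverts G"
    and v: "v \<notin> pverts G" and W: "W \<subseteq> pverts G" and z: "0 \<notin> Poly_Mapping.keys \<alpha>"
    and I: "I \<subseteq> Poly_Mapping.keys \<alpha>"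
    and allowed: "\<And>\<kappa> i. i \<in> Poly_Mapping.keys \<alpha> \<Longrightarrow>
       coloring_monomial G \<kappa> = \<alpha> - Poly_Mapping.single i 1 \<Longrightarrow> i \<notin> \<kappa> ` W \<longleftrightarrow> i \<in> I"
  shows "chromatic_sf (add_vertex v W G) \<alpha> = (\<Sum>i\<in>I. chromatic_sf G (\<alpha> - Poly_Mapping.single i 1))"
proof -
  let ?V = "pverts G" and ?G' = "add_vertex v W G"
  let ?S = "\<lambda>i. {\<kappa> \<in> proper_colorings G. coloring_monomial G \<kappa> = \<alpha> - Poly_Mapping.single i 1}"
  let ?T = "{\<kappa> \<in> proper_colorings ?G'. coloring_monomial ?G' \<kappa> = \<alpha>}"
  have V': "pverts ?G' = insert v ?V" by (simp add: add_vertex_def)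
  have finI: "finite I" using I by (rule finite_subset) simp
  have split: "\<kappa> \<in> ?T \<longleftrightarrow> \<kappa> \<in> insert v ?V \<rightarrow>\<^sub>E UNIV \<and> \<kappa> v \<in> I \<and> restrict \<kappa> ?V \<in> ?S (\<kappa> v)" for \<kappa>
  proof (cases "\<kappa> v \<in> Poly_Mapping.keys \<alpha>")
    case True
    let ?i = "\<kappa> v" and ?\<rho> = "restrict \<kappa> ?V"
    have i: "?i \<ge> 1" using True z by (metis less_one not_le)
    have "coloring_monomial ?G' \<kappa> = \<alpha> \<longleftrightarrow> Poly_Mapping.single ?i 1 + coloring_monomial G ?\<rho> = \<alpha>"
      using coloring_monomial_add_vertex[OF fin v] by simp
    also have "\<dots> \<longleftrightarrow> coloring_monomial G ?\<rho> = \<alpha> - Poly_Mapping.single ?i 1"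
    proof
      assume e: "coloring_monomial G ?\<rho> = \<alpha> - Poly_Mapping.single ?i 1"
      show "Poly_Mapping.single ?i 1 + coloring_monomial G ?\<rho> = \<alpha>"
        unfolding e using True
        by (intro poly_mapping_eqI) (auto simp: lookup_add lookup_minus lookup_single when_def in_keys_iff)
    qed auto
    finally have mon: "coloring_monomial ?G' \<kappa> = \<alpha> \<longleftrightarrow> coloring_monomial G ?\<rho> = \<alpha> - Poly_Mapping.single ?i 1" .
    have "?\<rho> ` W = \<kappa> ` W" using W by (intro image_cong) auto
    then have "?i \<notin> \<kappa> ` W \<longleftrightarrow> ?i \<in> I" if "coloring_monomial G ?\<rho> = \<alpha> - Poly_Mapping.single ?i 1"
      using allowed[OF True that] by simp
    then show ?thesis using mon i proper_colorings_add_vertex_iff[OF arcs v W, of \<kappa>] by auto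
  next
    case False
    have "finite (pverts ?G')" using fin V' by simp
    then have "\<kappa> \<notin> ?T" using False keys_coloring_monomial[of ?G' \<kappa>] V' by auto
    then show ?thesis using False I by blast
  qed
  have ext: "\<kappa>(v := i) \<in> insert v ?V \<rightarrow>\<^sub>E UNIV" "restrict (\<kappa>(v := i)) ?V = \<kappa>"
    if "\<kappa> \<in> ?S j" for \<kappa> i j
    using that v by (auto simp: proper_colorings_def PiE_def extensional_def restrict_def fun_eq_iff)
  have "bij_betw (\<lambda>(i, \<kappa>). \<kappa>(v := i)) (SIGMA i:I. ?S i) ?T"
  proof (rule bij_betw_byWitness[where f' = "\<lambda>\<kappa>. (\<kappa> v, restrict \<kappa> ?V)"])
    show "\<forall>x\<in>Sigma I ?S. (\<lambda>\<kappa>. (\<kappa> v, restrict \<kappa> ?V)) (case x of (i, \<kappa>) \<Rightarrow> \<kappa>(v := i)) = x"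
      using ext(2) by fastforce
    show "\<forall>\<kappa>\<in>?T. (case (\<kappa> v, restrict \<kappa> ?V) of (i, \<kappa>) \<Rightarrow> \<kappa>(v := i)) = \<kappa>"
    proof
      fix \<kappa> assume "\<kappa> \<in> ?T"
      then have "\<kappa> \<in> insert v ?V \<rightarrow>\<^sub>E UNIV" using split by blast
      then show "(case (\<kappa> v, restrict \<kappa> ?V) of (i, \<kappa>) \<Rightarrow> \<kappa>(v := i)) = \<kappa>"
        by (auto simp: PiE_def extensional_def restrict_def fun_eq_iff)
    qed
    show "(\<lambda>(i, \<kappa>). \<kappa>(v := i)) ` Sigma I ?S \<subseteq> ?T"
    proof (rule image_subsetI)
      fix x assume "x \<in> Sigma I ?S"
      then obtain i \<kappa> where x: "x = (i, \<kappa>)" "i \<in> I" "\<kappa> \<in> ?S i" by blast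
      have "\<kappa>(v := i) \<in> ?T" unfolding split using x ext[OF x(3), of i] by simp
      then show "(case x of (i, \<kappa>) \<Rightarrow> \<kappa>(v := i)) \<in> ?T" using x(1) by simp
    qed
    show "(\<lambda>\<kappa>. (\<kappa> v, restrict \<kappa> ?V)) ` ?T \<subseteq> Sigma I ?S"
      using split by blast
  qed
  then have "card ?T = card (SIGMA i:I. ?S i)" by (rule bij_betw_same_card[symmetric])
  also have "\<dots> = (\<Sum>i\<in>I. card (?S i))"
    using finI finite_colorings_of_monomial[OF fin] by (intro card_SigmaI) auto
  finally show ?thesis by (simp add: chromatic_sf_def)
qed

lemma keys_decrement_subset:
  "Poly_Mapping.keys (\<alpha> - Poly_Mapping.single i (1::nat)) \<subseteq> Poly_Mapping.keys \<alpha>"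
  by (auto simp: in_keys_iff lookup_minus)

text \<open>With no neighbors, every color that occurs in the monomial is available.\<close>

lemma has_coeffs_add_isolated:
  assumes G: "has_coeffs G c" and v: "v \<notin> pverts G"
  shows "has_coeffs (add_isolated v G) (isolated_coeff c)"
proof -
  have fin: "finite (pverts G)" and arcs: "parcs G \<subseteq> pverts G \<times> pverts G"
    and c: "\<And>\<alpha>. 0 \<notin> Poly_Mapping.keys \<alpha> \<Longrightarrow> chromatic_sf G \<alpha> = c (exponents \<alpha>)"
    using G by (auto simp: has_coeffs_def)
  have "chromatic_sf (add_isolated v G) \<alpha> = isolated_coeff c (exponents \<alpha>)"
    if z: "0 \<notin> Poly_Mapping.keys \<alpha>" for \<alpha>
  proof -
    have "chromatic_sf (add_isolated v G) \<alpha> =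
        (\<Sum>i\<in>Poly_Mapping.keys \<alpha>. chromatic_sf G (\<alpha> - Poly_Mapping.single i 1))"
      by (rule chromatic_sf_add_vertex[OF fin arcs v]) (simp_all add: z)
    also have "\<dots> = (\<Sum>i\<in>Poly_Mapping.keys \<alpha>. c (decrement_part (Poly_Mapping.lookup \<alpha> i) (exponents \<alpha>)))"
    proof (rule sum.cong[OF refl])
      fix i assume i: "i \<in> Poly_Mapping.keys \<alpha>"
      have "0 \<notin> Poly_Mapping.keys (\<alpha> - Poly_Mapping.single i 1)"
        using z keys_decrement_subset[of \<alpha> i] by (rule contra_subsetD[rotated])
      then show "chromatic_sf G (\<alpha> - Poly_Mapping.single i 1) =
          c (decrement_part (Poly_Mapping.lookup \<alpha> i) (exponents \<alpha>))"
        using c exponents_decrement[OF i] by metis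
    qed
    also have "\<dots> = isolated_coeff c (exponents \<alpha>)"
      unfolding isolated_coeff_def
      by (simp add: exponents_def sum_unfold_sum_mset multiset.map_comp comp_def)
    finally show ?thesis .
  qed
  then show ?thesis using fin arcs by (auto simp: has_coeffs_def add_vertex_def)
qed

text \<open>
  All other vertices are neighbors, so the color \<open>i\<close> is available exactly if it is used nowhere else, that is,
  if its exponent is \<open>1\<close>.
\<close>

lemma has_coeffs_add_dominating:
  assumes G: "has_coeffs G c" and v: "v \<notin> pverts G"
  shows "has_coeffs (add_dominating v G) (dominating_coeff c)"
proof -
  have fin: "finite (pverts G)" and arcs: "parcs G \<subseteq> pverts G \<times> pverts G"
    and c: "\<And>\<alpha>. 0 \<notin> Poly_Mapping.keys \<alpha> \<Longrightarrow> chromatic_sf G \<alpha> = c (exponents \<alpha>)"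
    using G by (auto simp: has_coeffs_def)
  have "chromatic_sf (add_dominating v G) \<alpha> = dominating_coeff c (exponents \<alpha>)"
    if z: "0 \<notin> Poly_Mapping.keys \<alpha>" for \<alpha>
  proof -
    let ?I = "{i \<in> Poly_Mapping.keys \<alpha>. Poly_Mapping.lookup \<alpha> i = 1}"
    have "chromatic_sf (add_dominating v G) \<alpha> =
        (\<Sum>i\<in>?I. chromatic_sf G (\<alpha> - Poly_Mapping.single i 1))"
    proof (rule chromatic_sf_add_vertex[OF fin arcs v subset_refl z])
      fix \<kappa> i
      assume i: "i \<in> Poly_Mapping.keys \<alpha>"
        and m: "coloring_monomial G \<kappa> = \<alpha> - Poly_Mapping.single i 1"
      have "\<kappa> ` pverts G = Poly_Mapping.keys (\<alpha> - Poly_Mapping.single i 1)"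
        using keys_coloring_monomial[OF fin, of \<kappa>] m by simp
      then show "i \<notin> \<kappa> ` pverts G \<longleftrightarrow> i \<in> ?I"
        using i by (auto simp: in_keys_iff lookup_minus lookup_single)
    qed auto
    also have "\<dots> = (\<Sum>i\<in>?I. c (exponents \<alpha> - {#1#}))"
    proof (rule sum.cong[OF refl])
      fix i assume i: "i \<in> ?I"
      have "0 \<notin> Poly_Mapping.keys (\<alpha> - Poly_Mapping.single i 1)"
        using z keys_decrement_subset[of \<alpha> i] by (rule contra_subsetD[rotated])
      moreover have "exponents (\<alpha> - Poly_Mapping.single i 1) = exponents \<alpha> - {#1#}"
        using exponents_decrement[of i \<alpha>] i by (simp add: decrement_part_def del: One_nat_def)
      ultimately show "chromatic_sf G (\<alpha> - Poly_Mapping.single i 1) = c (exponents \<alpha> - {#1#})"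
        using c by metis
    qed
    also have "\<dots> = dominating_coeff c (exponents \<alpha>)"
    proof -
      have "count (exponents \<alpha>) 1 = card ?I"
      proof -
        have "count (exponents \<alpha>) 1 =
            (\<Sum>i\<in>Poly_Mapping.lookup \<alpha> -` {1} \<inter> Poly_Mapping.keys \<alpha>. count (mset_set (Poly_Mapping.keys \<alpha>)) i)"
          by (simp only: exponents_def count_image_mset finite_set_mset_mset_set[OF finite_keys])
        also have "\<dots> = (\<Sum>i\<in>Poly_Mapping.lookup \<alpha> -` {1} \<inter> Poly_Mapping.keys \<alpha>. 1)"
          by (intro sum.cong) (auto simp: count_mset_set')
        also have "\<dots> = card (Poly_Mapping.lookup \<alpha> -` {1} \<inter> Poly_Mapping.keys \<alpha>)" by simp
        also have "Poly_Mapping.lookup \<alpha> -` {1} \<inter> Poly_Mapping.keys \<alpha> = ?I" by blast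
        finally show ?thesis .
      qed
      then show ?thesis by (simp add: dominating_coeff_def)
    qed
    finally show ?thesis .
  qed
  then show ?thesis using fin arcs by (auto simp: has_coeffs_def add_vertex_def)
qed

section \<open>The coefficients of \<open>N\<^sub>r\<close>\<close>

definition complete_graph :: "'a set \<Rightarrow> 'a pair_pre_digraph" where
  "complete_graph U = \<lparr> pverts = U, parcs = {(u, v). (u, v) \<in> U \<times> U \<and> u \<noteq> v} \<rparr>"

lemma complete_graph_iff:
  "K\<^bsub>n\<^esub> (with_proj A) \<longleftrightarrow> finite (pverts A) \<and> card (pverts A) = n \<and> A = complete_graph (pverts A)"
  by (cases A) (auto simp: complete_digraph_pair_def complete_graph_def)

text \<open>Joining with \<open>K\<^sub>n\<close> amounts to adding \<open>n\<close> dominating vertices, one after the other.\<close>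

lemma has_coeffs_join_complete:
  assumes "finite U" "U \<inter> pverts G = {}" "has_coeffs G c"
  shows "has_coeffs (complete_graph U \<or>\<^sub>g G) ((dominating_coeff ^^ card U) c)"
  using assms
proof (induction U rule: finite_induct)
  case empty
  have "complete_graph {} \<or>\<^sub>g G = G"
    by (simp add: complete_graph_def graph_join_def disjoint_union_def)
  then show ?case using empty by simp
next
  case (insert a U)
  have "complete_graph (insert a U) \<or>\<^sub>g G = add_dominating a (complete_graph U \<or>\<^sub>g G)"
    using insert.hyps(2)
    by (auto simp: complete_graph_def graph_join_def disjoint_union_def add_vertex_def)
  moreover have "a \<notin> pverts (complete_graph U \<or>\<^sub>g G)"
    using insert.hyps(2) insert.prems(1) by (auto simp: complete_graph_def graph_join_def disjoint_union_def)
  ultimately show ?case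
    using insert has_coeffs_add_dominating[of "complete_graph U \<or>\<^sub>g G" _ a] by simp
qed

definition unit_coeff :: "nat multiset \<Rightarrow> nat" where
  "unit_coeff M = (if M = {#} then 1 else 0)"

definition K2_2K1_coeff :: "nat multiset \<Rightarrow> nat" where
  "K2_2K1_coeff = isolated_coeff (isolated_coeff (dominating_coeff (dominating_coeff unit_coeff)))"

definition N_coeff :: "nat \<Rightarrow> nat multiset \<Rightarrow> nat" where
  "N_coeff r = (dominating_coeff ^^ r) K2_2K1_coeff"

text \<open>
  The graph \<open>K\<^sub>2\<close> is read as the join of \<open>K\<^sub>2\<close> with the empty graph, and \<open>K\<^sub>2 \<squnion> 2K\<^sub>1\<close> as \<open>K\<^sub>2\<close> with two isolated
  vertices added.
\<close>

lemma has_coeffs_N: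
  assumes "is_N r G"
  shows "has_coeffs G (N_coeff r)" and "card (pverts G) = r + 4"
proof -
  obtain A B C where A: "K\<^bsub>r\<^esub> (with_proj A)" and B: "K\<^bsub>2\<^esub> (with_proj B)" and C: "edgeless 2 C"
    and d: "pverts B \<inter> pverts C = {}" "pverts A \<inter> pverts (B \<squnion>\<^sub>g C) = {}"
    and G: "G = A \<or>\<^sub>g (B \<squnion>\<^sub>g C)"
    using assms by (auto simp: is_N_def)
  obtain c1 c2 where c: "pverts C = {c1, c2}" "c1 \<noteq> c2"
    using C by (auto simp: edgeless_def card_2_iff)
  have finA: "finite (pverts A)" "card (pverts A) = r" and A': "A = complete_graph (pverts A)"
    using A complete_graph_iff by blast+
  have finB: "finite (pverts B)" "card (pverts B) = 2" and B': "B = complete_graph (pverts B)"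
    using B complete_graph_iff by blast+
  have e: "has_coeffs (empty_graph :: 'a pair_pre_digraph) unit_coeff"
    using has_coeffs_empty by (simp add: unit_coeff_def[abs_def])
  have "complete_graph (pverts B) \<or>\<^sub>g empty_graph = B"
    by (subst (2) B') (simp add: complete_graph_def graph_join_def disjoint_union_def empty_graph_def)
  then have hB: "has_coeffs B (dominating_coeff (dominating_coeff unit_coeff))"
    using has_coeffs_join_complete[OF finB(1) _ e] finB(2)
    by (simp add: empty_graph_def numeral_2_eq_2)
  have "B \<squnion>\<^sub>g C = add_isolated c1 (add_isolated c2 B)"
    using C c by (simp add: disjoint_union_def add_vertex_def edgeless_def insert_commute)
  moreover have "c2 \<notin> pverts B" "c1 \<notin> pverts (add_isolated c2 B)"
    using c d(1) by (auto simp: add_vertex_def)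
  ultimately have "has_coeffs (B \<squnion>\<^sub>g C) K2_2K1_coeff"
    unfolding K2_2K1_coeff_def using hB has_coeffs_add_isolated by metis
  from has_coeffs_join_complete[OF finA(1) d(2) this]
  show "has_coeffs G (N_coeff r)" unfolding N_coeff_def G using A' finA(2) by simp
  have "card (pverts (B \<squnion>\<^sub>g C)) = 4" "finite (pverts (B \<squnion>\<^sub>g C))"
    using finB c d(1) by (auto simp: disjoint_union_def card_Un_disjoint)
  then show "card (pverts G) = r + 4"
    using finA d(2) unfolding G
    by (simp add: graph_join_def disjoint_union_def[of A] card_Un_disjoint)
qed

lemma K2_2K1_coeff_values:
  "K2_2K1_coeff {#3, 1#} = 2"
  "K2_2K1_coeff {#2, 2#} = 4"
  "K2_2K1_coeff {#2, 1, 1#} = 10"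
  "K2_2K1_coeff {#1, 1, 1, 1#} = 24"
  by (simp_all add: K2_2K1_coeff_def isolated_coeff_def dominating_coeff_def unit_coeff_def decrement_part_def numeral_eq_Suc)

section \<open>The support of the coefficients\<close>

text \<open>
  A dominating vertex uses up a part of its own, an isolated vertex need not. This bounds the number of parts
  from below; for \<open>N\<^sub>r\<close> the bound is its chromatic number \<open>r + 2\<close>.
\<close>

lemma dominating_coeff_support:
  assumes "\<And>M. c M > 0 \<Longrightarrow> k \<le> size M" and "dominating_coeff c M > 0"
  shows "Suc k \<le> size M"
proof -
  have "1 \<in># M" "c (M - {#1#}) > 0" using assms(2) by (auto simp: dominating_coeff_def)
  then show ?thesis using assms(1)[of "M - {#1#}"] size_Diff_singleton[of 1 M]
    by (metis One_nat_def Suc_le_mono Suc_pred nonempty_has_size empty_iff set_mset_empty)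
qed

lemma isolated_coeff_support:
  assumes "\<And>M. c M > 0 \<Longrightarrow> k \<le> size M" and "isolated_coeff c M > 0"
  shows "k \<le> size M"
proof -
  obtain p where p: "p \<in># M" "c (decrement_part p M) > 0"
  proof -
    have "\<exists>p\<in>#M. c (decrement_part p M) \<noteq> 0"
      using assms(2) unfolding isolated_coeff_def by (auto simp: neq0_conv[symmetric] simp del: neq0_conv)
    then show ?thesis using that by blast
  qed
  then have "size (decrement_part p M) \<le> size M"
    by (auto simp: decrement_part_def size_Diff_singleton dest!: multi_member_split)
  then show ?thesis using assms(1)[OF p(2)] by simp
qed

lemma N_coeff_support:
  assumes "N_coeff r M > 0"
  shows "r + 2 \<le> size M"
  using assms
proof (induction r arbitrary: M)
  case 0
  have 1: "1 \<le> size M" if "dominating_coeff unit_coeff M > 0" for M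
    using dominating_coeff_support[of unit_coeff 0 M] that by simp
  have 2: "2 \<le> size M" if "dominating_coeff (dominating_coeff unit_coeff) M > 0" for M
    using dominating_coeff_support[of "dominating_coeff unit_coeff" 1 M] that 1 by simp
  have 3: "2 \<le> size M" if "isolated_coeff (dominating_coeff (dominating_coeff unit_coeff)) M > 0" for M
    using isolated_coeff_support[of "dominating_coeff (dominating_coeff unit_coeff)" 2 M] that 2 by simp
  have "2 \<le> size M"
    using isolated_coeff_support[OF 3] 0 by (simp add: N_coeff_def K2_2K1_coeff_def)
  then show ?case by simp
next
  case (Suc r)
  then show ?case using dominating_coeff_support[of "N_coeff r" "r + 2" M]
    by (simp add: N_coeff_def)
qed

text \<open>
  Each step adds one part \<open>1\<close> and one dominating vertex, which may take any of the parts \<open>1\<close> present at that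
  moment: the factors are \<open>k + 1, \<dots>, k + r\<close> for \<open>k = count M 1\<close>. Multiplying by \<open>k!\<close> avoids the quotient
  \<open>(k + r)! / k!\<close>.
\<close>

lemma N_coeff_add_ones:
  "fact (count M 1) * N_coeff r (M + replicate_mset r 1) = fact (count M 1 + r) * K2_2K1_coeff M"
proof (induction r)
  case 0
  then show ?case by (simp add: N_coeff_def)
next
  case (Suc r)
  have "N_coeff (Suc r) (M + replicate_mset (Suc r) 1) =
      (count M 1 + Suc r) * N_coeff r (M + replicate_mset r 1)"
    by (simp add: N_coeff_def dominating_coeff_def)
  then have "fact (count M 1) * N_coeff (Suc r) (M + replicate_mset (Suc r) 1) =
      (count M 1 + Suc r) * (fact (count M 1) * N_coeff r (M + replicate_mset r 1))"
    by (simp only: mult.left_commute)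
  also have "\<dots> = (count M 1 + Suc r) * (fact (count M 1 + r) * K2_2K1_coeff M)"
    by (simp only: Suc.IH)
  also have "\<dots> = fact (count M 1 + Suc r) * K2_2K1_coeff M"
    by (simp only: add_Suc_right fact_Suc of_nat_id mult.assoc)
  finally show ?case .
qed

lemma N_coeff_values:
  "N_coeff r ({#3, 1#} + replicate_mset r 1) = 2 * fact (r + 1)"
  "N_coeff r ({#2, 2#} + replicate_mset r 1) = 4 * fact r"
  "N_coeff r ({#2, 1, 1#} + replicate_mset r 1) = 5 * fact (r + 2)"
  "N_coeff r ({#1, 1, 1, 1#} + replicate_mset r 1) = fact (r + 4)"
proof -
  have f: "fact (2::nat) = (2::nat)" "fact (4::nat) = (24::nat)" by (simp_all add: numeral_eq_Suc)
  have n: "count {#3, 1::nat#} 1 = 1" "count {#2, 2::nat#} 1 = 0" "count {#2, 1, 1::nat#} 1 = 2"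
      "count {#1, 1, 1, 1::nat#} 1 = 4"
    by simp_all
  note v = N_coeff_add_ones[of "{#3, 1#}" r] N_coeff_add_ones[of "{#2, 2#}" r]
    N_coeff_add_ones[of "{#2, 1, 1#}" r] N_coeff_add_ones[of "{#1, 1, 1, 1#}" r]
  note v = v[unfolded n K2_2K1_coeff_values f]
  show "N_coeff r ({#3, 1#} + replicate_mset r 1) = 2 * fact (r + 1)"
    using v(1) by (simp only: fact_1 mult_1 mult.commute add.commute)
  show "N_coeff r ({#2, 2#} + replicate_mset r 1) = 4 * fact r"
    using v(2) by (simp only: fact_0 mult_1 mult.commute add_0)
  show "N_coeff r ({#2, 1, 1#} + replicate_mset r 1) = 5 * fact (r + 2)"
    using v(3) unfolding add.commute[of 2 r] by linarith
  show "N_coeff r ({#1, 1, 1, 1#} + replicate_mset r 1) = fact (r + 4)"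
    using v(4) unfolding add.commute[of 4 r] by linarith
qed

text \<open>
  The parts exceed \<open>1\<close> by at most \<open>2\<close> in total, so besides ones there is nothing, one part \<open>2\<close> or \<open>3\<close>, or two
  parts \<open>2\<close>. This leaves the four partitions whose coefficients are known.
\<close>

lemma N_coeff_lower_bound:
  assumes "r \<ge> 1" and "0 \<notin># M" and "sum_mset M = r + 4" and "r + 2 \<le> size M"
  shows "4 * fact r \<le> N_coeff r M"
proof -
  \<comment> \<open>\<open>B\<close> holds the parts greater than \<open>1\<close>\<close>
  define B where "B = filter_mset (\<lambda>x. x \<noteq> 1) M"
  define k where "k = count M 1"
  have M: "M = B + replicate_mset k 1"
    unfolding B_def k_def by (rule multiset_eqI) simp
  have big: "x \<ge> 2" if "x \<in># B" for x
  proof -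
    have "x \<in># M" "x \<noteq> 1" using that by (simp_all add: B_def)
    moreover have "x \<noteq> 0" using calculation(1) assms(2) by metis
    ultimately show ?thesis by linarith
  qed
  have sum: "sum_mset B + k = r + 4" and size: "r + 2 \<le> size B + k"
    using assms(3,4) unfolding M by (simp_all add: sum_mset_replicate_mset)
  have ge: "2 * size X \<le> sum_mset X" if "\<And>x. x \<in># X \<Longrightarrow> x \<ge> 2" for X :: "nat multiset"
    using that by (induction X) (fastforce+)
  have "size B \<le> 2" using ge[of B] big sum size by fastforce
  then consider "size B = 0" | "size B = Suc 0" | "size B = Suc (Suc 0)" by linarith
  then have "\<exists>M0. M = M0 + replicate_mset r 1 \<and>
     (M0 = {#3, 1#} \<or> M0 = {#2, 2#} \<or> M0 = {#2, 1, 1#} \<or> M0 = {#1, 1, 1, 1#})"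
  proof cases
    case 1
    then have B: "B = {#}" by simp
    have "k = 4 + r" using sum unfolding B by simp
    then have "M = {#1, 1, 1, 1#} + replicate_mset r 1"
      using M B by (simp add: numeral_eq_Suc)
    then show ?thesis by blast
  next
    case 2
    then obtain x where B: "B = {#x#}" using size_1_singleton_mset[of B] by auto
    have "x \<ge> 2" using big[of x] unfolding B by simp
    then consider "x = 2" "k = 2 + r" | "x = 3" "k = 1 + r"
      using sum size unfolding B by (simp, linarith)
    then show ?thesis
    proof cases
      case 1
      then have "M = {#2, 1, 1#} + replicate_mset r 1" using M B by (simp add: numeral_eq_Suc)
      then show ?thesis by blast
    next
      case 2
      then have "M = {#3, 1#} + replicate_mset r 1" using M B by simp
      then show ?thesis by blast
    qed
  next
    case 3
    then obtain x N where N: "B = add_mset x N" using size_eq_Suc_imp_eq_union by blast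
    then obtain y where "N = {#y#}" using 3 size_1_singleton_mset[of N] by auto
    then have B: "B = {#x, y#}" using N by simp
    have "x \<ge> 2" "y \<ge> 2" using big[of x] big[of y] unfolding B by simp_all
    then have "x = 2" "y = 2" "k = r" using sum size unfolding B by simp_all
    then have "M = {#2, 2#} + replicate_mset r 1" using M B by simp
    then show ?thesis by blast
  qed
  moreover have "4 * fact r \<le> 2 * (fact (r + 1) :: nat)"
  proof -
    have "4 * fact r \<le> (2 * (r + 1)) * (fact r :: nat)"
      using assms(1) by (intro mult_le_mono1) simp
    then show ?thesis by (simp add: algebra_simps)
  qed
  moreover have "4 * fact r \<le> 5 * (fact (r + 2) :: nat)"
    using fact_mono[of r "r + 2", where 'a = nat] by linarith
  moreover have "4 * fact r \<le> (fact (r + 4) :: nat)"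
  proof -
    have "4 * fact r \<le> (r + 4) * (fact (r + 3) :: nat)"
      using fact_mono[of r "r + 3", where 'a = nat] by (intro mult_le_mono) simp_all
    also have "\<dots> = fact (r + 4)" using fact_Suc[of "r + 3", where 'a = nat] by (simp add: numeral_eq_Suc)
    finally show ?thesis .
  qed
  ultimately show ?thesis using N_coeff_values[of r] by fastforce
qed

text \<open>
  The first \<open>length \<nu>\<close> parts of \<open>\<nu>\<close> already sum to \<open>n\<close>, hence so do those of \<open>\<mu>\<close>, and no positive part of \<open>\<mu>\<close>
  can follow.
\<close>

lemma dominance_length_le:
  assumes "\<mu> \<in> partitions n" "\<nu> \<in> partitions n" "\<mu> \<unrhd> \<nu>"
  shows "length \<mu> \<le> length \<nu>"
proof (rule ccontr)
  assume less: "\<not> length \<mu> \<le> length \<nu>"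
  have "\<mu> \<noteq> []" using less by auto
  then have "n > 0" using assms(1) by (cases \<mu>) (auto simp: partitions_def)
  then have "\<nu> \<noteq> []" using assms(2) by (auto simp: partitions_def)
  then have "length \<nu> \<ge> 1" by (cases \<nu>) auto
  then have "sum_list (take (length \<nu>) \<nu>) \<le> sum_list (take (length \<nu>) \<mu>)"
    using assms(3) unfolding dominance_ge_def by blast
  then have "sum_list \<nu> \<le> sum_list (take (length \<nu>) \<mu>)" by simp
  moreover have "sum_list \<nu> = n" "sum_list \<mu> = n" and pos: "0 \<notin> set \<mu>"
    using assms(1,2) by (simp_all add: partitions_def)
  moreover have "sum_list (take (length \<nu>) \<mu>) + sum_list (drop (length \<nu>) \<mu>) = sum_list \<mu>"
    by (simp flip: sum_list_append)
  ultimately have "sum_list (drop (length \<nu>) \<mu>) = 0" by linarith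
  then have "set (drop (length \<nu>) \<mu>) \<subseteq> {0}" by (simp add: sum_list_eq_0_iff subset_eq)
  then have "drop (length \<nu>) \<mu> = []"
    using pos set_drop_subset[of "length \<nu>" \<mu>] by (cases "drop (length \<nu>) \<mu>") auto
  then show False using less by simp
qed

section \<open>The level depth of \<open>N\<^sub>r\<close>\<close>

lemma level_depth_eqI:
  assumes "\<And>k. k \<ge> 1 \<Longrightarrow> level_nice k G \<longleftrightarrow> k \<le> m"
  shows "level_depth G = enat m"
proof -
  have "{k. k \<ge> 1 \<and> level_nice k G} = {1..m}" using assms by auto
  then have *: "level_depth G = Sup (enat ` {1..m} \<union> {0})" by (simp add: level_depth_def)
  show ?thesis unfolding *
  proof (rule antisym)
    show "Sup (enat ` {1..m} \<union> {0}) \<le> enat m" by (rule Sup_least) auto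
    show "enat m \<le> Sup (enat ` {1..m} \<union> {0})"
      by (rule Sup_upper) (cases m; auto simp: zero_enat_def)
  qed
qed

definition hook_partition :: "nat \<Rightarrow> nat list" where
  "hook_partition r = 3 # replicate (Suc r) 1"

definition two_twos_partition :: "nat \<Rightarrow> nat list" where
  "two_twos_partition r = 2 # 2 # replicate r 1"

lemma hook_two_twos:
  shows "hook_partition r \<in> partitions (r + 4)" "two_twos_partition r \<in> partitions (r + 4)"
    and "hook_partition r \<unrhd> two_twos_partition r"
proof -
  show "hook_partition r \<in> partitions (r + 4)" "two_twos_partition r \<in> partitions (r + 4)"
    by (auto simp: hook_partition_def two_twos_partition_def partitions_def sum_list_replicate sorted_wrt_append
      simp flip: replicate_append_same intro!: sorted_wrt_iff_nth_less[THEN iffD2])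
  show "hook_partition r \<unrhd> two_twos_partition r"
    unfolding dominance_ge_def
  proof (intro allI impI)
    fix k :: nat assume "k \<ge> 1"
    then consider "k = 1" | j where "k = Suc (Suc j)" by (cases k; cases "k - 1"; simp)
    then show "sum_list (take k (two_twos_partition r)) \<le> sum_list (take k (hook_partition r))"
      by cases (simp_all add: hook_partition_def two_twos_partition_def sum_list_replicate)
  qed
qed

context
  fixes r :: nat and G :: "'a pair_pre_digraph"
  assumes r: "r \<ge> 2" and N: "is_N r G"
begin

lemma mono_coeff_N:
  assumes "\<mu> \<in> partitions (r + 4)"
  shows "mono_coeff G \<mu> = N_coeff r (mset \<mu>)"
  using mono_coeff_has_coeffs[OF pair_graph_is_N[OF N] has_coeffs_N(1)[OF N]] has_coeffs_N(2)[OF N] assms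
  by simp

lemma mono_coeff_N_ge:
  assumes "\<mu> \<in> partitions (r + 4)" "\<nu> \<in> partitions (r + 4)" "\<mu> \<unrhd> \<nu>" "mono_coeff G \<mu> > 0"
  shows "4 * fact r \<le> mono_coeff G \<nu>"
proof -
  have "r + 2 \<le> length \<mu>" using N_coeff_support[of r "mset \<mu>"] assms by (simp add: mono_coeff_N)
  then have "r + 2 \<le> size (mset \<nu>)" using dominance_length_le[OF assms(1-3)] by simp
  moreover have "0 \<notin># mset \<nu>" "sum_mset (mset \<nu>) = r + 4"
    using assms(2) by (auto simp: partitions_def sum_mset_sum_list)
  ultimately show ?thesis using N_coeff_lower_bound[of r "mset \<nu>"] r mono_coeff_N[OF assms(2)] by simp
qed

text \<open>The descent from \<open>2(r + 1)!\<close> to \<open>4 r!\<close> is strict because \<open>r + 1 > 2\<close>.\<close>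

lemma mono_coeff_hook_two_twos:
  "mono_coeff G (two_twos_partition r) = 4 * fact r" "mono_coeff G (hook_partition r) > 4 * fact r"
proof -
  show "mono_coeff G (two_twos_partition r) = 4 * fact r"
    using N_coeff_values(2)[of r] mono_coeff_N[OF hook_two_twos(2)] by (simp add: two_twos_partition_def)
  have "mono_coeff G (hook_partition r) = 2 * fact (r + 1)"
    using N_coeff_values(1)[of r] mono_coeff_N[OF hook_two_twos(1)] by (simp add: hook_partition_def)
  also have "\<dots> > 4 * fact r" using r by simp
  finally show "mono_coeff G (hook_partition r) > 4 * fact r" .
qed

lemma level_depth_N: "level_depth G = enat (4 * fact r)"
proof (rule level_depth_eqI)
  fix k :: nat assume "k \<ge> 1"
  show "level_nice k G \<longleftrightarrow> k \<le> 4 * fact r"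
  proof
    assume k: "k \<le> 4 * fact r"
    show "level_nice k G"
      unfolding level_nice_def has_coeffs_N(2)[OF N]
    proof (intro ballI impI)
      fix \<mu> \<nu> j
      assume a: "\<mu> \<in> partitions (r + 4)" "\<nu> \<in> partitions (r + 4)" "\<mu> \<unrhd> \<nu>"
        and j: "j \<in> {1..k}" "j \<le> mono_coeff G \<mu>"
      have "mono_coeff G \<mu> > 0" using j by auto
      then show "j \<le> mono_coeff G \<nu>" using mono_coeff_N_ge[OF a] j(1) k by auto
    qed
  next
    assume nk: "level_nice k G"
    show "k \<le> 4 * fact r"
    proof (rule ccontr)
      assume "\<not> k \<le> 4 * fact r"
      then have "Suc (4 * fact r) \<in> {1..k}" by simp
      moreover have "Suc (4 * fact r) \<le> mono_coeff G (hook_partition r)" using mono_coeff_hook_two_twos(2) by simp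
      ultimately have "Suc (4 * fact r) \<le> mono_coeff G (two_twos_partition r)"
        using nk hook_two_twos unfolding level_nice_def has_coeffs_N(2)[OF N] by blast
      then show False using mono_coeff_hook_two_twos(1) by simp
    qed
  qed
qed

lemma nice_N: "nice G"
proof -
  have "0 < 4 * (fact r :: nat)" by simp
  then show ?thesis
    unfolding nice_def has_coeffs_N(2)[OF N] using mono_coeff_N_ge less_le_trans by blast
qed

lemma not_strongly_nice_N: "\<not> strongly_nice G"
  using hook_two_twos mono_coeff_hook_two_twos
  unfolding strongly_nice_def has_coeffs_N(2)[OF N] by (metis not_le)

text \<open>Any vertex of the factor \<open>K\<^sub>r\<close> is adjacent to all other vertices.\<close>

lemma connected_N: "Digraph_Component.connected (with_proj G)"
proof -
  obtain A B C where A: "K\<^bsub>r\<^esub> (with_proj A)" and G: "G = A \<or>\<^sub>g (B \<squnion>\<^sub>g C)"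
    using N by (auto simp: is_N_def)
  have cA: "card (pverts A) = r" and arcsA: "parcs A = {(u, v). (u, v) \<in> pverts A \<times> pverts A \<and> u \<noteq> v}"
    using A by (auto simp: complete_digraph_pair_def)
  have "pverts A \<noteq> {}" using cA r by auto
  then obtain a where a: "a \<in> pverts A" by blast
  have aG: "a \<in> pverts G" using a by (simp add: G graph_join_def disjoint_union_def)
  have arc: "(a, v) \<in> parcs G" "(v, a) \<in> parcs G" if "v \<in> pverts G" "v \<noteq> a" for v
    using that a arcsA by (auto simp: G graph_join_def disjoint_union_def)
  interpret pair_graph G by (rule pair_graph_is_N[OF N])
  have "v \<rightarrow>\<^sup>*\<^bsub>with_proj G\<^esub> a \<and> a \<rightarrow>\<^sup>*\<^bsub>with_proj G\<^esub> v" if "v \<in> pverts G" for v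
    using arc[OF that] aG that by (cases "v = a") auto
  then have "u \<rightarrow>\<^sup>*\<^bsub>with_proj G\<^esub> v" if "u \<in> pverts G" "v \<in> pverts G" for u v
    using that reachable_trans[of u a v] by simp
  then show ?thesis
    unfolding Digraph_Component.connected_def
    using aG by (intro strongly_connectedI reachable_mk_symmetricI) auto
qed

end

theorem theorem5p5:
  shows "(\<forall>r\<ge>2. \<forall>N :: 'a pair_pre_digraph. is_N r N \<longrightarrow> level_depth N = enat (4 * fact r)) \<and>
    (\<forall>M :: nat. \<exists>G :: nat pair_pre_digraph. pair_graph G \<and> Digraph_Component.connected (with_proj G) \<and>
       nice G \<and> \<not> strongly_nice G \<and> level_depth G < \<infinity> \<and> enat M \<le> level_depth G)"
proof (intro conjI allI impI)
  fix r :: nat and N :: "'a pair_pre_digraph"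
  assume "r \<ge> 2" "is_N r N"
  then show "level_depth N = enat (4 * fact r)" by (rule level_depth_N)
next
  fix M :: nat
  \<comment> \<open>\<open>r \<ge> M\<close> suffices, since \<open>4 r! \<ge> r\<close>\<close>
  define r where "r = max 2 M"
  have r: "r \<ge> 2" "M \<le> r" by (simp_all add: r_def)
  obtain G :: "nat pair_pre_digraph" where N: "is_N r G" using ex_is_N by blast
  have "M \<le> fact r" using r(2) fact_ge_self[of r] by linarith
  then have "enat M \<le> level_depth G" using level_depth_N[OF r(1) N] by simp
  moreover have "level_depth G < \<infinity>" using level_depth_N[OF r(1) N] by simp
  ultimately show "\<exists>G :: nat pair_pre_digraph. pair_graph G \<and> Digraph_Component.connected (with_proj G) \<and>
       nice G \<and> \<not> strongly_nice G \<and> level_depth G < \<infinity> \<and> enat M \<le> level_depth G"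
    using pair_graph_is_N[OF N] connected_N[OF r(1) N] nice_N[OF r(1) N] not_strongly_nice_N[OF r(1) N]
    by blast
qed

end
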